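(* Let $\beta_g\ge\alpha_g>0$ and $\kappa_g=\beta_g/\alpha_g$. For any connected simple undirected graph $\mathcal{G}=(\mathcal{V},\mathcal{E})$ with nodes $\{1,\dots,n\}$ and diameter $\Delta>0$, and any black-box procedure over $\mathcal{G}$ with communication time $\tau$, there exist functions $f_i:\ell_2\to\mathbb{R}$, $i=1,\dots,n$, whose average $\bar f=\frac1n\sum_{i=1}^nf_i$ is $\alpha_g$-strongly convex and $\beta_g$-smooth (so that $\kappa_g$ is the global condition number), such that the time to reach a precision $\varepsilon>0$ is lower bounded by $$\Omega\left(\sqrt{\kappa_g}\,\big(1+\Delta\tau\big)\ln\left(\frac1\varepsilon\right)\right).$$
   Context: Notation: $g(\varepsilon)=\Omega(f(\varepsilon))$ means that there exists $C>0$ such that for all $\varepsilon>0$, $g(\varepsilon)\ge Cf(\varepsilon)$; in the bound of the claim, additive terms that do not depend on the precision $\varepsilon$ are, for simplicity, omitted. $\ell_2=\{\theta=(\theta_k)_{k\in\mathbb{N}}:\sum_k\theta_k^2<+\infty\}$. $f^*$ applied to a function denotes its Fenchel conjugate. A function is $\beta$-smooth if it is differentiable with $\beta$-Lipschitz gradient. Each local function $f_i$ is assumed to be strongly convex and smooth. Black-box procedure: a distributed algorithm run on the nodes of $\mathcal{G}$, where node $i$ has access to $f_i$, a local computation takes time $1$, and a communication between neighbors takes time $\tau>0$ (which may be smaller or greater than $1$); computations and communications may be performed in parallel and asynchronously. It satisfies the following constraints. (1) Local memory: at each time $t\ge0$ node $i$ can store past values in a finite internal memory $\mathcal{M}_{i,t}\subset\ell_2$,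 with $\mathcal{M}_{i,0}=\{0\}$ and $\mathcal{M}_{i,t}\subset\mathcal{M}^{comp}_{i,t}\cup\mathcal{M}^{comm}_{i,t}$ for $t>0$. (2) Local computation: $\mathcal{M}^{comp}_{i,t}=\mathrm{Span}(\{\theta,\nabla f_i(\theta),\nabla f_i^*(\theta):\theta\in\mathcal{M}_{i,t-1}\})$. (3) Local communication: $\mathcal{M}^{comm}_{i,t}=\mathrm{Span}\big(\bigcup_{(i,j)\in\mathcal{E}}\mathcal{M}_{j,t-\tau}\big)$. (4) Output value: at each time $t$ node $i$ specifies a vector $\theta_{i,t}\in\mathcal{M}_{i,t}$ as its local output. Convention: memories at negative times are empty, and $\mathrm{Span}(\emptyset)=\{0\}$. Time to reach precision $\varepsilon$: the first time $t$ at which all local outputs satisfy $\bar f(\theta_{i,t})-\bar f(\theta^* )\le\varepsilon$, $i=1,\dots,n$, where $\theta^*$ is the minimizer of $\bar f$ (it is $+\infty$ if this never happens).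
   Formalization: The case κ_g = 1 (β_g = α_g) is excluded, since there flooding the gradients at 0 gives the exact minimizer in a time independent of ε; the constant C in Ω is uniform over all κ_g ≥ κ_0 for each fixed κ_0 > 1. *)

theory Defs
  imports "HOL-Analysis.Analysis" "Graph_Theory.Graph_Theory"
begin

section \<open>The Hilbert space of square-summable sequences\<close>

typedef ell2 = "{\<theta> :: nat \<Rightarrow> real. summable (\<lambda>k. (\<theta> k)\<^sup>2)}"
  morphisms coord Abs_ell2
  by (rule exI[of _ "\<lambda>_. 0"]) simp

setup_lifting type_definition_ell2

lemma summable_mult_ell2:
  fixes x y :: "nat \<Rightarrow> real"
  assumes "summable (\<lambda>k. (x k)\<^sup>2)" "summable (\<lambda>k. (y k)\<^sup>2)"
  shows "summable (\<lambda>k. x k * y k)"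
proof (rule summable_comparison_test')
  show "summable (\<lambda>k. (x k)\<^sup>2 + (y k)\<^sup>2)"
    using assms by (rule summable_add)
  fix k
  have "2 * \<bar>x k\<bar> * \<bar>y k\<bar> \<le> (x k)\<^sup>2 + (y k)\<^sup>2"
    using sum_squares_bound[of "\<bar>x k\<bar>" "\<bar>y k\<bar>"] by simp
  moreover have "0 \<le> \<bar>x k\<bar> * \<bar>y k\<bar>"
    by (intro mult_nonneg_nonneg abs_ge_zero)
  ultimately show "norm (x k * y k) \<le> (x k)\<^sup>2 + (y k)\<^sup>2"
    unfolding real_norm_def abs_mult by linarith
qed

instantiation ell2 :: real_inner
begin

lift_definition zero_ell2 :: ell2 is "\<lambda>_. 0" by simp

lift_definition plus_ell2 :: "ell2 \<Rightarrow> ell2 \<Rightarrow> ell2" is "\<lambda>x y k. x k + y k"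
proof -
  fix x y :: "nat \<Rightarrow> real"
  assume a: "summable (\<lambda>k. (x k)\<^sup>2)" "summable (\<lambda>k. (y k)\<^sup>2)"
  then have "summable (\<lambda>k. (x k)\<^sup>2 + (y k)\<^sup>2 + 2 * (x k * y k))"
    by (intro summable_add summable_mult summable_mult_ell2)
  then show "summable (\<lambda>k. (x k + y k)\<^sup>2)"
    by (simp add: power2_sum algebra_simps)
qed

lift_definition scaleR_ell2 :: "real \<Rightarrow> ell2 \<Rightarrow> ell2" is "\<lambda>c x k. c * x k"
  by (simp add: power_mult_distrib)

lift_definition uminus_ell2 :: "ell2 \<Rightarrow> ell2" is "\<lambda>x k. - x k" by simp

definition minus_ell2 :: "ell2 \<Rightarrow> ell2 \<Rightarrow> ell2" where
  "minus_ell2 x y = x + - y"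

lift_definition inner_ell2 :: "ell2 \<Rightarrow> ell2 \<Rightarrow> real" is "\<lambda>x y. \<Sum>k. x k * y k" .

definition norm_ell2 :: "ell2 \<Rightarrow> real" where
  "norm_ell2 x = sqrt (inner x x)"

definition sgn_ell2 :: "ell2 \<Rightarrow> ell2" where
  "sgn_ell2 x = inverse (norm x) *\<^sub>R x"

definition dist_ell2 :: "ell2 \<Rightarrow> ell2 \<Rightarrow> real" where
  "dist_ell2 x y = norm (x - y)"

definition uniformity_ell2 :: "(ell2 \<times> ell2) filter" where
  "uniformity_ell2 = (INF e\<in>{0<..}. principal {(x, y). dist x y < e})"

definition open_ell2 :: "ell2 set \<Rightarrow> bool" where
  "open_ell2 U \<longleftrightarrow> (\<forall>x\<in>U. eventually (\<lambda>(x', y). x' = x \<longrightarrow> y \<in> U) uniformity)"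

instance
proof
  fix x y z :: ell2 and a b r :: real and U :: "ell2 set"
  show "x + y + z = x + (y + z)" by transfer (simp add: algebra_simps)
  show "x + y = y + x" by transfer (simp add: algebra_simps)
  show "0 + x = x" by transfer simp
  show "- x + x = 0" by transfer simp
  show "x - y = x + - y" by (simp add: minus_ell2_def)
  show "a *\<^sub>R (x + y) = a *\<^sub>R x + a *\<^sub>R y" by transfer (simp add: algebra_simps)
  show "(a + b) *\<^sub>R x = a *\<^sub>R x + b *\<^sub>R x" by transfer (simp add: algebra_simps)
  show "a *\<^sub>R b *\<^sub>R x = (a * b) *\<^sub>R x" by transfer (simp add: algebra_simps)
  show "1 *\<^sub>R x = x" by transfer simp
  show "sgn x = inverse (norm x) *\<^sub>R x" by (simp add: sgn_ell2_def)
  show "dist x y = norm (x - y)" by (simp add: dist_ell2_def)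
  show "uniformity = (INF e\<in>{0<..}. principal {(x, y :: ell2). dist x y < e})"
    by (simp add: uniformity_ell2_def)
  show "open U \<longleftrightarrow> (\<forall>x\<in>U. eventually (\<lambda>(x', y). x' = x \<longrightarrow> y \<in> U) uniformity)"
    by (simp add: open_ell2_def)
  show "inner x y = inner y x" by transfer (simp add: mult.commute)
  show "inner (x + y) z = inner x z + inner y z"
    by transfer (simp add: distrib_right suminf_add summable_mult_ell2)
  show "inner (r *\<^sub>R x) y = r * inner x y"
    by transfer (simp add: mult.assoc suminf_mult summable_mult_ell2)
  show "0 \<le> inner x x"
    by transfer (auto intro!: suminf_nonneg simp flip: power2_eq_square)
  show "inner x x = 0 \<longleftrightarrow> x = 0"
    by transfer (simp add: suminf_eq_zero_iff fun_eq_iff flip: power2_eq_square)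
  show "norm x = sqrt (inner x x)" by (simp add: norm_ell2_def)
qed

end

section \<open>Smooth and strongly convex functions\<close>

definition grad :: "('a::real_inner \<Rightarrow> real) \<Rightarrow> 'a \<Rightarrow> 'a" where
  "grad f x = (THE D. GDERIV f x :> D)"

definition smooth :: "real \<Rightarrow> ('a::real_inner \<Rightarrow> real) \<Rightarrow> bool" where
  "smooth \<beta> f \<longleftrightarrow> (\<forall>x. GDERIV f x :> grad f x) \<and> \<beta>-lipschitz_on UNIV (grad f)"

definition strongly_convex :: "real \<Rightarrow> ('a::real_inner \<Rightarrow> real) \<Rightarrow> bool" where
  "strongly_convex \<alpha> f \<longleftrightarrow> convex_on UNIV (\<lambda>x. f x - \<alpha> / 2 * (norm x)\<^sup>2)"

text \<open>The supremum is finite for the strongly convex, smooth functions to which it is applied.\<close>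

definition fenchel_conjugate :: "('a::real_inner \<Rightarrow> real) \<Rightarrow> 'a \<Rightarrow> real" where
  "fenchel_conjugate f y = (SUP x. inner y x - f x)"

definition average :: "nat \<Rightarrow> (nat \<Rightarrow> 'a \<Rightarrow> real) \<Rightarrow> 'a \<Rightarrow> real" where
  "average n f x = (\<Sum>i=1..n. f i x) / real n"

definition admissible :: "nat \<Rightarrow> (nat \<Rightarrow> 'a::real_inner \<Rightarrow> real) \<Rightarrow> bool" where
  "admissible n f \<longleftrightarrow>
     (\<forall>i\<in>{1..n}. (\<exists>\<alpha>>0. strongly_convex \<alpha> (f i)) \<and> (\<exists>\<beta>. smooth \<beta> (f i)))"

section \<open>Networks\<close>

text \<open>An undirected edge is represented by its two arcs.\<close>

definition network :: "nat \<Rightarrow> nat pair_pre_digraph \<Rightarrow> bool" where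
  "network n G \<longleftrightarrow> pair_graph G \<and> Digraph_Component.connected (with_proj G) \<and> pverts G = {1..n}"

text \<open>With unit weights, the shortest-path cost is the hop distance.\<close>

definition graph_diameter :: "'a pair_pre_digraph \<Rightarrow> real" where
  "graph_diameter G =
     real_of_ereal (SUP u\<in>pverts G. SUP v\<in>pverts G. wf_digraph.\<mu> (with_proj G) (\<lambda>_. 1) u v)"

section \<open>Black-box procedures\<close>

record execution =
  mem :: "nat \<Rightarrow> real \<Rightarrow> ell2 set"
  outp :: "nat \<Rightarrow> real \<Rightarrow> ell2"

definition comp_mem :: "(nat \<Rightarrow> ell2 \<Rightarrow> real) \<Rightarrow> execution \<Rightarrow> nat \<Rightarrow> real \<Rightarrow> ell2 set" where
  "comp_mem f X i t =
     span (\<Union>\<theta>\<in>mem X i (t - 1). {\<theta>, grad (f i) \<theta>, grad (fenchel_conjugate (f i)) \<theta>})"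

definition comm_mem :: "nat pair_pre_digraph \<Rightarrow> real \<Rightarrow> execution \<Rightarrow> nat \<Rightarrow> real \<Rightarrow> ell2 set" where
  "comm_mem G \<tau> X i t = span (\<Union>j\<in>{j. (i, j) \<in> parcs G}. mem X j (t - \<tau>))"

definition black_box_execution ::
    "nat pair_pre_digraph \<Rightarrow> real \<Rightarrow> (nat \<Rightarrow> ell2 \<Rightarrow> real) \<Rightarrow> execution \<Rightarrow> bool" where
  "black_box_execution G \<tau> f X \<longleftrightarrow>
     (\<forall>i\<in>pverts G.
        (\<forall>t<0. mem X i t = {}) \<and>
        mem X i 0 = {0} \<and>
        (\<forall>t\<ge>0. finite (mem X i t)) \<and>
        (\<forall>t>0. mem X i t \<subseteq> comp_mem f X i t \<union> comm_mem G \<tau> X i t) \<and>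
        (\<forall>t\<ge>0. outp X i t \<in> mem X i t))"

text \<open>A procedure maps every admissible family of local functions to an execution. As
  in the span constraints themselves, no further restriction is placed on how the memories and
  outputs are chosen.\<close>

definition black_box_procedure ::
    "nat \<Rightarrow> nat pair_pre_digraph \<Rightarrow> real \<Rightarrow> ((nat \<Rightarrow> ell2 \<Rightarrow> real) \<Rightarrow> execution) \<Rightarrow> bool" where
  "black_box_procedure n G \<tau> P \<longleftrightarrow> (\<forall>f. admissible n f \<longrightarrow> black_box_execution G \<tau> f (P f))"

definition time_to_precision ::
    "nat \<Rightarrow> (nat \<Rightarrow> ell2 \<Rightarrow> real) \<Rightarrow> execution \<Rightarrow> real \<Rightarrow> ereal" where
  "time_to_precision n f X \<epsilon> =
     (let fbar = average n f; \<theta>opt = arg_min fbar (\<lambda>_. True)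
      in Inf {ereal t | t. 0 \<le> t \<and> (\<forall>i\<in>{1..n}. fbar (outp X i t) - fbar \<theta>opt \<le> \<epsilon>)})"

end

theory Submission
  imports Defs
begin

text \<open>
  The average is Nesterov's worst-case quadratic for first-order methods. With
  \<open>s = (\<beta> - \<alpha>) / 4\<close> it is
  \<open>\<alpha>/2 \<parallel>x\<parallel>\<^sup>2 + s/2 (\<Sum>k. (x\<^sub>k - x\<^sub>k\<^sub>+\<^sub>1)\<^sup>2) - \<langle>b, x\<rangle>\<close> with \<open>b\<close> supported on
  coordinate 0. The chain term couples neighbouring coordinates only, and the minimiser is a
  geometric sequence of ratio \<open>q = (\<surd>\<kappa> - 1) / (\<surd>\<kappa> + 1)\<close>
  (\<open>chain_hessian_geometric\<close>), so a point vanishing from coordinate \<open>k\<close> on has a gap of order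
  at least \<open>q\<^sup>2\<^sup>k\<close>.

  To make each new coordinate cost a trip across the network, the chain is split between two nodes
  \<open>u\<close>, \<open>v\<close> at distance \<open>\<Delta>\<close>: \<open>v\<close> holds the couplings of the pairs (0,1), (2,3), ...,
  and \<open>u\<close> those of (1,2), (3,4), ... together with the linear term. Every node
  also holds \<open>\<alpha>/2 \<parallel>x\<parallel>\<^sup>2\<close>, and those other than \<open>u\<close> and \<open>v\<close> hold nothing else and can only
  relay. The local Hessians are then block diagonal with blocks of size at most 2, and so are their inverses. Hence neither the gradient
  nor the gradient of the conjugate at \<open>u\<close> goes beyond an odd number of leading coordinates, nor
  at \<open>v\<close> beyond an even number (\<open>oracles_split_chain\<close>). The
  two nodes have to alternate, each turn taking one computation and \<open>\<Delta>\<close> communications, so that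
  \<open>k\<close> coordinates confine \<open>u\<close> at every time \<open>t < k (1 + \<Delta> \<tau>)\<close>
  (\<open>memory_confined\<close>).

  The resulting gap \<open>q\<^sup>2\<^sup>m\<close>, where \<open>m = \<lfloor>t / (1 + \<Delta> \<tau>)\<rfloor>\<close>, is turned into a bound on
  the time by \<open>ln (1/q) \<le> 2 / (\<surd>\<kappa> - 1)\<close>. As \<open>\<kappa>\<close> stays away from 1, \<open>\<surd>\<kappa> - 1\<close> is at
  least a fixed multiple of \<open>\<surd>\<kappa>\<close>. The additive
  terms of the usual estimate vanish because the minimiser may be scaled freely: its size is chosen
  to make the constant in front of \<open>q\<^sup>2\<^sup>m\<close> equal to 1.
\<close>

section \<open>Quadratic functions on an inner product space\<close>

definition self_adjoint :: "('a::real_inner \<Rightarrow> 'a) \<Rightarrow> bool" where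
  "self_adjoint L \<longleftrightarrow> bounded_linear L \<and> (\<forall>x y. inner (L x) y = inner x (L y))"

definition quadratic :: "('a::real_inner \<Rightarrow> 'a) \<Rightarrow> 'a \<Rightarrow> 'a \<Rightarrow> real" where
  "quadratic L b x = inner x (L x) / 2 - inner b x"

lemma grad_eqI:
  assumes "GDERIV f x :> D"
  shows "grad f x = D"
  unfolding grad_def
proof (rule the_equality)
  show "GDERIV f x :> D" by (rule assms)
  fix D' assume "GDERIV f x :> D'"
  then have "(\<lambda>h. inner h D') = (\<lambda>h. inner h D)"
    using assms unfolding gderiv_def by (rule has_derivative_unique)
  then have "inner (D' - D) D' = inner (D' - D) D"
    by meson
  then have "inner (D' - D) (D' - D) = 0"
    by (simp add: inner_diff_right)
  then show "D' = D" by simp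
qed

lemma GDERIV_quadratic:
  assumes "self_adjoint L"
  shows "GDERIV (quadratic L b) x :> L x - b"
proof -
  have bl: "bounded_linear L" and sym: "inner (L x) y = inner x (L y)" for x y
    using assms by (auto simp: self_adjoint_def)
  have "(quadratic L b has_derivative
      (\<lambda>h. (inner x (L h) + inner h (L x)) / 2 - inner b h)) (at x)"
    unfolding quadratic_def
    by (auto intro!: derivative_eq_intros bounded_linear.has_derivative[OF bl])
  moreover have "inner x (L h) = inner h (L x)" for h
    by (metis sym inner_commute)
  ultimately show ?thesis
    unfolding gderiv_def by (simp add: inner_diff_right inner_commute[of b])
qed

lemma grad_quadratic: "self_adjoint L \<Longrightarrow> grad (quadratic L b) x = L x - b"
  by (rule grad_eqI[OF GDERIV_quadratic])

lemma smooth_quadratic: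
  assumes "self_adjoint L" and bound: "\<And>x. norm (L x) \<le> M * norm x" and "0 \<le> M"
  shows "smooth M (quadratic L b)"
  unfolding smooth_def
proof (intro conjI allI lipschitz_onI)
  have bl: "bounded_linear L" using assms(1) by (simp add: self_adjoint_def)
  fix x y
  have "L x - b - (L y - b) = L (x - y)"
    by (simp add: linear_diff[OF bounded_linear.linear[OF bl]])
  then show "dist (grad (quadratic L b) x) (grad (quadratic L b) y) \<le> M * dist x y"
    by (simp add: grad_quadratic[OF assms(1)] dist_norm bound)
qed (use assms in \<open>auto simp: grad_quadratic GDERIV_quadratic\<close>)

text \<open>The second-order Taylor formula is exact here. Strong convexity, growth away from a critical
  point and the computation of the conjugate all come from the sign of its last term.\<close>

lemma quadratic_expansion:
  assumes "self_adjoint L"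
  shows "quadratic L b y = quadratic L b x + inner (L x - b) (y - x) + inner (y - x) (L (y - x)) / 2"
proof -
  have bl: "linear L" and sym: "inner (L x) y = inner x (L y)" for x y
    using assms by (auto simp: self_adjoint_def bounded_linear.linear)
  have "inner y (L x) = inner x (L y)" "inner (L x) y = inner x (L y)" "inner (L x) x = inner x (L x)"
    by (metis sym inner_commute)+
  then show ?thesis
    by (simp add: quadratic_def linear_diff[OF bl] inner_diff_left inner_diff_right field_simps)
qed

lemma quadratic_growth:
  assumes "self_adjoint L" and coercive: "\<And>x. m * (norm x)\<^sup>2 \<le> inner x (L x)" and "L z = b"
  shows "m / 2 * (norm (x - z))\<^sup>2 \<le> quadratic L b x - quadratic L b z"
  using quadratic_expansion[OF assms(1), of b x z] coercive[of "x - z"] assms(3) by simp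

lemma strongly_convex_quadratic:
  assumes sa: "self_adjoint L" and coercive: "\<And>x. m * (norm x)\<^sup>2 \<le> inner x (L x)"
  shows "strongly_convex m (quadratic L b)"
  unfolding strongly_convex_def
proof (rule convex_onI)
  \<comment> \<open>Subtracting \<open>m/2 \<parallel>x\<parallel>\<^sup>2\<close> leaves a quadratic with the positive Hessian \<open>K\<close>, which lies
    above its tangents; convexity follows by averaging the tangent inequality at \<open>z\<close>.\<close>
  define K where "K = (\<lambda>x. L x - m *\<^sub>R x)"
  have bl: "bounded_linear L" and sym: "inner (L x) y = inner x (L y)" for x y
    using sa by (auto simp: self_adjoint_def)
  have K: "self_adjoint K"
    unfolding self_adjoint_def K_def
    by (auto intro!: bounded_linear_sub bl bounded_linear_scaleR_right
        simp: inner_diff_left inner_diff_right sym)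
  have psd: "0 \<le> inner x (K x)" for x
    using coercive[of x] by (simp add: K_def inner_diff_right power2_norm_eq_inner)
  have eq: "quadratic L b x - m / 2 * (norm x)\<^sup>2 = quadratic K b x" for x
    by (simp add: quadratic_def K_def inner_diff_right power2_norm_eq_inner field_simps)
  fix t :: real and x y :: 'a
  assume t: "0 < t" "t < 1"
  define z where "z = (1 - t) *\<^sub>R x + t *\<^sub>R y"
  have tangent: "quadratic K b w \<ge> quadratic K b z + inner (K z - b) (w - z)" for w
    using quadratic_expansion[OF K, of b w z] psd[of "w - z"] by simp
  have "(1 - t) *\<^sub>R (x - z) + t *\<^sub>R (y - z) = 0"
    by (simp add: z_def algebra_simps)
  then have 0: "(1 - t) * inner (K z - b) (x - z) + t * inner (K z - b) (y - z) = 0"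
    by (metis inner_add_right inner_scaleR_right inner_zero_right)
  have "(1 - t) * (quadratic K b z + inner (K z - b) (x - z))
      + t * (quadratic K b z + inner (K z - b) (y - z))
      \<le> (1 - t) * quadratic K b x + t * quadratic K b y"
    using t by (intro add_mono mult_left_mono tangent) auto
  also have "(1 - t) * (quadratic K b z + inner (K z - b) (x - z))
      + t * (quadratic K b z + inner (K z - b) (y - z)) = quadratic K b z"
    using 0 by (simp add: algebra_simps)
  finally show "quadratic L b ((1 - t) *\<^sub>R x + t *\<^sub>R y) - m / 2 * (norm ((1 - t) *\<^sub>R x + t *\<^sub>R y))\<^sup>2
    \<le> (1 - t) * (quadratic L b x - m / 2 * (norm x)\<^sup>2) + t * (quadratic L b y - m / 2 * (norm y)\<^sup>2)"
    unfolding eq z_def .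
qed auto

text \<open>The conjugate of a quadratic function with invertible Hessian \<open>L\<close> is, up to a constant,
  the quadratic function with Hessian \<open>R = L\<^sup>-\<^sup>1\<close>: the supremum is attained at \<open>R (y + b)\<close>.\<close>

lemma grad_fenchel_conjugate_quadratic:
  assumes sa: "self_adjoint L" and psd: "\<And>x. 0 \<le> inner x (L x)"
    and R: "bounded_linear R" and LR: "\<And>x. L (R x) = x"
  shows "grad (fenchel_conjugate (quadratic L b)) y = R (y + b)"
proof -
  have sym: "inner (L x) y = inner x (L y)" for x y
    using sa by (auto simp: self_adjoint_def)
  have symR: "inner (R x) y = inner x (R y)" for x y
    by (metis LR sym)
  have saR: "self_adjoint R" using R symR by (simp add: self_adjoint_def)
  have linR: "linear R" using R by (rule bounded_linear.linear)
  have conj: "fenchel_conjugate (quadratic L b) y = quadratic R (- R b) y + inner b (R b) / 2" for y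
  proof -
    define z where "z = R (y + b)"
    have z: "L z = y + b" by (simp add: z_def LR)
    have split: "inner y x - quadratic L b x = - quadratic L (y + b) x" for x
      by (simp add: quadratic_def inner_add_left)
    have "- quadratic L (y + b) x \<le> - quadratic L (y + b) z" for x
      using quadratic_expansion[OF sa, of "y + b" x z] psd[of "x - z"] z by simp
    then have "(SUP x. - quadratic L (y + b) x) = - quadratic L (y + b) z"
      by (intro cSup_eq_maximum) auto
    also have "\<dots> = inner (y + b) (R (y + b)) / 2"
      by (simp add: quadratic_def z z_def[symmetric] inner_commute)
    also have "inner (y + b) (R (y + b)) = inner y (R y) + 2 * inner (R b) y + inner b (R b)"
      using symR[of b y] by (simp add: linear_add[OF linR] inner_add_left inner_add_right inner_commute[of y])
    also have "\<dots> / 2 = quadratic R (- R b) y + inner b (R b) / 2"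
      by (simp add: quadratic_def)
    finally show ?thesis
      unfolding fenchel_conjugate_def split .
  qed
  have "GDERIV (\<lambda>y. quadratic R (- R b) y + inner b (R b) / 2) y :> (R y - (- R b)) + 0"
    by (intro GDERIV_add GDERIV_const GDERIV_quadratic saR)
  then show ?thesis
    unfolding conj[abs_def] by (intro grad_eqI) (simp add: linear_add[OF linR])
qed

section \<open>Swapping neighbouring coordinates\<close>

lemma coord_simps [simp]:
  "coord 0 k = 0" "coord (x + y) k = coord x k + coord y k"
  "coord (- x) k = - coord x k" "coord (c *\<^sub>R x) k = c * coord x k"
  by (simp_all add: zero_ell2.rep_eq plus_ell2.rep_eq uminus_ell2.rep_eq scaleR_ell2.rep_eq)

lemma coord_diff [simp]: "coord (x - y) k = coord x k - coord y k"
  using coord_simps(2)[of x "- y" k] by simp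

lemma power2_norm_ell2: "(norm (x :: ell2))\<^sup>2 = (\<Sum>k. (coord x k)\<^sup>2)"
  unfolding power2_norm_eq_inner inner_ell2.rep_eq by (simp add: power2_eq_square)

lemma summable_coord: "summable (\<lambda>k. (coord x k)\<^sup>2)"
  using coord[of x] by simp

lemma coord_power2_le_norm: "(coord x k)\<^sup>2 \<le> (norm x)\<^sup>2"
  using sum_le_suminf[OF summable_coord, of "{k}" x] by (simp add: power2_norm_ell2)

text \<open>For \<open>b = True\<close> the partners are (0,1), (2,3), ...; for \<open>b = False\<close> they are
  (1,2), (3,4), ..., and truncated subtraction makes 0 its own partner.\<close>

definition partner :: "bool \<Rightarrow> nat \<Rightarrow> nat" where
  "partner b k = (if even k = b then k + 1 else k - 1)"

lemma partner_partner [simp]: "partner b (partner b k) = k"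
  by (cases "even k = b"; cases k) (auto simp: partner_def)

lemma inj_partner: "inj (partner b)"
  by (rule inj_on_inverseI[of _ "partner b"]) simp

lemma surj_partner: "range (partner b) = UNIV"
  by (rule surjI[of _ "partner b"]) simp

lift_definition swap :: "bool \<Rightarrow> ell2 \<Rightarrow> ell2" is "\<lambda>b x k. x (partner b k)"
proof -
  fix b and x :: "nat \<Rightarrow> real"
  assume "summable (\<lambda>k. (x k)\<^sup>2)"
  from summable_reindex[OF this inj_partner[of b]] show "summable (\<lambda>k. (x (partner b k))\<^sup>2)"
    by (simp add: o_def)
qed

lemma coord_swap [simp]: "coord (swap b x) k = coord x (partner b k)"
  by (rule fun_cong[OF swap.rep_eq])

lemma ell2_eqI: "(\<And>k. coord x k = coord y k) \<Longrightarrow> x = y"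
  by (simp add: fun_eq_iff flip: coord_inject)

lemma swap_swap [simp]: "swap b (swap b x) = x"
  by (rule ell2_eqI) simp

lemma swap_add: "swap b (x + y) = swap b x + swap b y"
  and swap_scaleR: "swap b (c *\<^sub>R x) = c *\<^sub>R swap b x"
  by (auto intro: ell2_eqI)

lemma norm_swap [simp]: "norm (swap b x) = norm x"
proof -
  have "(norm (swap b x))\<^sup>2 = (norm x)\<^sup>2"
    using suminf_reindex[OF summable_coord inj_partner, of x b]
    by (simp add: power2_norm_ell2 o_def surj_partner)
  then show ?thesis by simp
qed

lemma bounded_linear_swap: "bounded_linear (swap b)"
  by (rule bounded_linear_intro[where K = 1]) (auto simp: swap_add swap_scaleR)

text \<open>An isometry preserves inner products, and an isometric involution is therefore self-adjoint.\<close>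

lemma inner_swap: "inner (swap b x) y = inner x (swap b y)"
proof -
  have "inner (swap b x) (swap b z) = inner x z" for z
    by (simp add: dot_norm flip: swap_add)
  from this[of "swap b y"] show ?thesis by simp
qed

lemma abs_inner_swap_le: "\<bar>inner x (swap b x)\<bar> \<le> (norm x)\<^sup>2"
  using Cauchy_Schwarz_ineq2[of x "swap b x"] by (simp add: power2_eq_square)

definition coords_below :: "nat \<Rightarrow> ell2 set" where
  "coords_below k = {x. \<forall>j\<ge>k. coord x j = 0}"

lemma subspace_coords_below: "subspace (coords_below k)"
  by (auto simp: subspace_def coords_below_def)

lemma coords_below_mono: "k \<le> l \<Longrightarrow> coords_below k \<subseteq> coords_below l"
  by (auto simp: coords_below_def)

text \<open>The parity condition says that no pair of partners straddles the boundary between \<open>k - 1\<close>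
  and \<open>k\<close>.\<close>

lemma swap_coords_below:
  assumes "x \<in> coords_below k" "even k = b"
  shows "swap b x \<in> coords_below k"
proof -
  have "k \<le> partner b j" if "k \<le> j" for j
    using that assms(2) by (cases "j = k") (auto simp: partner_def)
  then show ?thesis using assms(1) by (auto simp: coords_below_def)
qed

section \<open>The chain functions\<close>

text \<open>For \<open>a = \<alpha> + s\<close> this is the Hessian of
  \<open>\<alpha>/2 \<parallel>x\<parallel>\<^sup>2 + s/2 \<Sum> (x\<^sub>i - x\<^sub>j)\<^sup>2\<close>, summed over the pairs \<open>{i, j}\<close> of partners.\<close>

definition pair_hessian :: "bool \<Rightarrow> real \<Rightarrow> real \<Rightarrow> ell2 \<Rightarrow> ell2" where
  "pair_hessian p a s x = a *\<^sub>R x - s *\<^sub>R swap p x"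

lemma bounded_linear_pair_hessian: "bounded_linear (pair_hessian p a s)"
  unfolding pair_hessian_def[abs_def]
  by (intro bounded_linear_sub bounded_linear_scaleR_right
      bounded_linear_compose[OF bounded_linear_scaleR_right bounded_linear_swap])

lemma self_adjoint_pair_hessian: "self_adjoint (pair_hessian p a s)"
  unfolding self_adjoint_def
  by (auto simp: bounded_linear_pair_hessian pair_hessian_def inner_diff_left inner_diff_right inner_swap)

lemma pair_hessian_coercive:
  assumes "0 \<le> s"
  shows "(a - s) * (norm x)\<^sup>2 \<le> inner x (pair_hessian p a s x)"
proof -
  have "s * inner x (swap p x) \<le> s * (norm x)\<^sup>2"
    using abs_inner_swap_le[of x p] assms by (intro mult_left_mono) auto
  then show ?thesis
    by (simp add: pair_hessian_def inner_diff_right power2_norm_eq_inner algebra_simps)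
qed

lemma norm_pair_hessian_le:
  assumes "0 \<le> s" "0 \<le> a"
  shows "norm (pair_hessian p a s x) \<le> (a + s) * norm x"
  using norm_triangle_ineq4[of "a *\<^sub>R x" "s *\<^sub>R swap p x"] assms
  by (simp add: pair_hessian_def algebra_simps)

text \<open>Since \<open>swap p\<close> is an involution \<open>J\<close>, \<open>(a - s J) (a + s J) = a\<^sup>2 - s\<^sup>2\<close>.\<close>

lemma pair_hessian_inverse:
  assumes "0 \<le> s" "s < a"
  shows "pair_hessian p a s ((1 / (a\<^sup>2 - s\<^sup>2)) *\<^sub>R pair_hessian p a (- s) x) = x"
proof -
  have "s\<^sup>2 < a\<^sup>2" using assms by (intro power_strict_mono) auto
  then have ne: "a\<^sup>2 - s\<^sup>2 \<noteq> 0" by simp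
  have "pair_hessian p a s ((1 / (a\<^sup>2 - s\<^sup>2)) *\<^sub>R pair_hessian p a (- s) x)
      = ((a\<^sup>2 - s\<^sup>2) / (a\<^sup>2 - s\<^sup>2)) *\<^sub>R x"
    by (rule ell2_eqI) (simp add: pair_hessian_def power2_eq_square field_simps flip: add_divide_distrib diff_divide_distrib)
  then show ?thesis using ne by simp
qed

lemma pair_hessian_coords_below:
  assumes "x \<in> coords_below k" "s \<noteq> 0 \<Longrightarrow> even k = p"
  shows "pair_hessian p a s x \<in> coords_below k"
proof (cases "s = 0")
  case True
  then show ?thesis using assms(1) by (auto simp: pair_hessian_def coords_below_def)
next
  case False
  then show ?thesis
    unfolding pair_hessian_def using assms
    by (intro subspace_diff subspace_scale subspace_coords_below swap_coords_below) auto
qed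

text \<open>Inverting the Hessian does not help an algorithm to reach new coordinates, because the inverse
  is again a combination of the identity and the same swap.\<close>

lemma pair_quadratic_oracles_coords_below:
  assumes "0 \<le> s" "s < a" "s \<noteq> 0 \<Longrightarrow> even k = p" "b \<in> coords_below k" "x \<in> coords_below k"
  defines "f \<equiv> quadratic (pair_hessian p a s) b"
  shows "grad f x \<in> coords_below k" "grad (fenchel_conjugate f) x \<in> coords_below k"
proof -
  have "grad f x = pair_hessian p a s x - b"
    unfolding f_def by (rule grad_quadratic[OF self_adjoint_pair_hessian])
  then show "grad f x \<in> coords_below k"
    using assms by (simp add: subspace_diff subspace_coords_below pair_hessian_coords_below)
  define R where "R = (\<lambda>y. (1 / (a\<^sup>2 - s\<^sup>2)) *\<^sub>R pair_hessian p a (- s) y)"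
  have "bounded_linear R"
    unfolding R_def
    by (rule bounded_linear_compose[OF bounded_linear_scaleR_right bounded_linear_pair_hessian])
  moreover have "0 \<le> inner y (pair_hessian p a s y)" for y
    using pair_hessian_coercive[OF assms(1), of a y p] assms(2)
    by (meson diff_ge_0_iff_ge less_imp_le mult_nonneg_nonneg order_trans zero_le_power2)
  ultimately have "grad (fenchel_conjugate f) x = R (x + b)"
    unfolding f_def using assms(1,2)
    by (intro grad_fenchel_conjugate_quadratic self_adjoint_pair_hessian)
      (auto simp: R_def pair_hessian_inverse)
  moreover have "R (x + b) \<in> coords_below k"
    unfolding R_def using assms
    by (intro subspace_scale[OF subspace_coords_below] pair_hessian_coords_below
        subspace_add[OF subspace_coords_below]) auto
  ultimately show "grad (fenchel_conjugate f) x \<in> coords_below k" by simp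
qed

text \<open>The two pairings together give the path \<open>0 - 1 - 2 - \<dots>\<close>: this operator is
  \<open>\<alpha> + s T\<close> with \<open>T\<close> the Laplacian of the half-infinite path.\<close>

definition chain_hessian :: "real \<Rightarrow> real \<Rightarrow> ell2 \<Rightarrow> ell2" where
  "chain_hessian \<alpha> s x = (\<alpha> + 2 * s) *\<^sub>R x - s *\<^sub>R swap False x - s *\<^sub>R swap True x"

lemma self_adjoint_chain_hessian: "self_adjoint (chain_hessian \<alpha> s)"
  unfolding self_adjoint_def chain_hessian_def[abs_def]
  by (auto intro!: bounded_linear_sub bounded_linear_scaleR_right
      bounded_linear_compose[OF bounded_linear_scaleR_right bounded_linear_swap]
      simp: inner_diff_left inner_diff_right inner_swap)

lemma chain_hessian_coercive:
  assumes "0 \<le> s"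
  shows "\<alpha> * (norm x)\<^sup>2 \<le> inner x (chain_hessian \<alpha> s x)"
proof -
  have "s * inner x (swap p x) \<le> s * (norm x)\<^sup>2" for p
    using abs_inner_swap_le[of x p] assms by (intro mult_left_mono) auto
  from this[of True] this[of False] show ?thesis
    by (simp add: chain_hessian_def inner_diff_right power2_norm_eq_inner algebra_simps)
qed

text \<open>Swaps are isometries, so \<open>T\<close> has norm at most 4; this is where the factor 4 between
  \<open>\<beta> - \<alpha>\<close> and \<open>s\<close> comes from.\<close>

lemma norm_chain_hessian_le:
  assumes "0 \<le> s" "0 \<le> \<alpha>"
  shows "norm (chain_hessian \<alpha> s x) \<le> (\<alpha> + 4 * s) * norm x"
proof -
  let ?y = "(\<alpha> + 2 * s) *\<^sub>R x" and ?z = "\<lambda>p. s *\<^sub>R swap p x"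
  have n: "norm ?y = (\<alpha> + 2 * s) * norm x" "norm (?z p) = s * norm x" for p
    using assms by simp_all
  have "norm (chain_hessian \<alpha> s x) \<le> (\<alpha> + 2 * s) * norm x + s * norm x + s * norm x"
    using norm_triangle_ineq4[of ?y "?z False"] norm_triangle_ineq4[of "?y - ?z False" "?z True"]
      n(1) n(2)[of False] n(2)[of True]
    unfolding chain_hessian_def by linarith
  then show ?thesis by (simp add: algebra_simps)
qed

text \<open>The default 0 outside \<open>\<bar>q\<bar> < 1\<close> only serves to keep the sequence square-summable.\<close>

lift_definition geometric :: "real \<Rightarrow> real \<Rightarrow> ell2" is
  "\<lambda>c q k. if \<bar>q\<bar> < 1 then c * q ^ k else 0"
proof -
  fix c q :: real
  have "summable (\<lambda>k. c\<^sup>2 * (q\<^sup>2) ^ k)" if "\<bar>q\<bar> < 1"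
    using that by (intro summable_mult summable_geometric) (simp add: abs_square_less_1)
  then show "summable (\<lambda>k. (if \<bar>q\<bar> < 1 then c * q ^ k else 0)\<^sup>2)"
    by (cases "\<bar>q\<bar> < 1") (simp_all add: power_mult_distrib power2_eq_square mult_ac)
qed

lemma coord_geometric: "\<bar>q\<bar> < 1 \<Longrightarrow> coord (geometric c q) k = c * q ^ k"
  by (simp add: geometric.rep_eq)

text \<open>At an interior coordinate the chain operator is a three-term recurrence whose
  characteristic equation has \<open>q\<close> as a root; only the boundary coordinate 0 survives. With its image
  as linear term, the geometric sequence is the minimiser of the chain function.\<close>

lemma chain_hessian_geometric:
  assumes "0 < q" "q < 1" and root: "(\<alpha> + 2 * s) * q = s * (q\<^sup>2 + 1)"
  shows "chain_hessian \<alpha> s (geometric c q) \<in> coords_below 1"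
proof -
  have "coord (chain_hessian \<alpha> s (geometric c q)) (Suc j) = 0" for j
  proof -
    have "coord (chain_hessian \<alpha> s (geometric c q)) (Suc j)
        = (\<alpha> + 2 * s) * (c * q ^ Suc j) - s * (c * q ^ (j + 2)) - s * (c * q ^ j)"
      using assms(1,2) by (simp add: chain_hessian_def coord_geometric partner_def)
    also have "\<dots> = c * q ^ j * ((\<alpha> + 2 * s) * q - s * (q\<^sup>2 + 1))"
      by (simp add: algebra_simps power2_eq_square)
    finally show ?thesis using root by simp
  qed
  then show ?thesis
    unfolding coords_below_def by (auto simp: Suc_le_eq gr0_conv_Suc)
qed

section \<open>Distances in the network\<close>

text \<open>The supremum defining the diameter is over a finite set and attained at some pair \<open>(u, v)\<close>;
  \<open>h\<close> is the distance from \<open>u\<close>. That an arc changes \<open>h\<close> by at most one is what limits the speed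
  at which information travels.\<close>

lemma network_distance_function:
  assumes "network n G" "graph_diameter G > 0"
  obtains u v and h :: "nat \<Rightarrow> real" where "u \<in> pverts G" "v \<in> pverts G"
    "h u = 0" "h v = graph_diameter G"
    "\<forall>i j. (i, j) \<in> parcs G \<longrightarrow> \<bar>h i - h j\<bar> \<le> 1"
proof -
  have G: "pair_graph G" and con: "Digraph_Component.connected (with_proj G)"
    using assms by (auto simp: network_def)
  interpret pair_graph G by (rule G)
  let ?m = "\<lambda>u v. \<mu> (\<lambda>_. 1) u v"
  have sc: "strongly_connected (with_proj G)"
    by (rule symmetric_connected_imp_strongly_connected[OF sym_arcs con])
  then have ne: "pverts G \<noteq> {}" and reach: "\<And>u v. u \<in> pverts G \<Longrightarrow> v \<in> pverts G \<Longrightarrow> u \<rightarrow>\<^sup>*\<^bsub>with_proj G\<^esub> v"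
    by (auto simp: strongly_connected_def)
  have nonneg: "0 \<le> ?m u v" for u v
    unfolding \<mu>_def
    by (intro INF_greatest) (auto intro: pos_cost_pos_awalk_cost)
  have fin: "\<bar>?m u v\<bar> \<noteq> \<infinity>" if "u \<in> pverts G" "v \<in> pverts G" for u v
    using reach[OF that] nonneg[of u v] \<mu>_reach_conv[of "\<lambda>_. 1" u v] by auto
  have finV: "finite (pverts G)" by simp
  have sup_in: "(SUP x\<in>pverts G. F x) \<in> F ` pverts G" for F :: "nat \<Rightarrow> ereal"
    using Max_in[of "F ` pverts G"] Max_Sup[of "F ` pverts G"] ne finV by simp
  obtain u v where uv: "u \<in> pverts G" "v \<in> pverts G"
    and d: "graph_diameter G = real_of_ereal (?m u v)"
    using sup_in[of "\<lambda>u. SUP v\<in>pverts G. ?m u v"] sup_in[of "?m _"]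
    unfolding graph_diameter_def by (smt (verit) imageE)
  have u0: "?m u u = 0"
    using min_cost_le_walk_cost[of u "[]" u "\<lambda>_. 1"] uv nonneg[of u u]
    by (simp add: awalk_Nil_iff zero_ereal_def[symmetric] antisym)
  have step: "real_of_ereal (?m u j) \<le> real_of_ereal (?m u i) + 1" if e: "(i, j) \<in> parcs G" for i j
  proof -
    have ij: "i \<in> pverts G" "j \<in> pverts G"
      using e by (auto dest: in_arcsD1 in_arcsD2)
    have "?m u j \<le> ?m u i + 1"
      using pos_cost_mu_triangle[of "\<lambda>_. 1" "(i, j)" i j u] e
      by (simp add: arc_to_ends_def one_ereal_def)
    then show ?thesis
      using fin[OF uv(1) ij(1)] fin[OF uv(1) ij(2)]
      by (cases "?m u i"; cases "?m u j") (auto simp: one_ereal_def)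
  qed
  show ?thesis
  proof (rule that[OF uv, of "\<lambda>i. real_of_ereal (?m u i)"])
    show "\<forall>i j. (i, j) \<in> parcs G \<longrightarrow>
        \<bar>real_of_ereal (?m u i) - real_of_ereal (?m u j)\<bar> \<le> 1"
    proof (intro allI impI)
      fix i j assume e: "(i, j) \<in> parcs G"
      then have "(j, i) \<in> parcs G"
        using pair_sym_arcs by (simp add: symmetric_def symD)
      with e show "\<bar>real_of_ereal (?m u i) - real_of_ereal (?m u j)\<bar> \<le> 1"
        using step[of i j] step[of j i] by auto
    qed
  qed (use u0 d in auto)
qed

section \<open>Spreading of non-zero coordinates\<close>

text \<open>
  Coordinate \<open>k\<close> can first become non-zero only at node \<open>source k\<close>, and not before time
  \<open>k (1 + \<Delta> \<tau>) + 1\<close>. From there it travels at speed \<open>1/\<tau>\<close>, and \<open>delay k i\<close> bounds from below the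
  number of hops to node \<open>i\<close>. For odd \<open>k\<close> the bound \<open>\<Delta> - h i\<close> replaces the distance from \<open>v\<close>: it too
  vanishes at \<open>v\<close>, changes by at most one along an arc, and equals \<open>\<Delta>\<close> at the other source, which
  is all the argument needs.
\<close>

lemma memory_confined:
  fixes h :: "nat \<Rightarrow> real" and u v :: nat and \<Delta> :: real
  defines "source k \<equiv> if even k then u else v"
    and "delay k i \<equiv> if even k then h i else \<Delta> - h i"
  assumes exec: "black_box_execution G \<tau> f X" and "0 < \<tau>"
    and verts: "\<And>i j. (i, j) \<in> parcs G \<Longrightarrow> j \<in> pverts G"
    and uv: "u \<noteq> v" "h u = 0" "h v = \<Delta>"
    and lip: "\<And>i j. (i, j) \<in> parcs G \<Longrightarrow> \<bar>h i - h j\<bar> \<le> 1"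
    and inv: "\<And>i k \<theta>. i \<in> pverts G \<Longrightarrow> i \<noteq> source k \<Longrightarrow> \<theta> \<in> coords_below k \<Longrightarrow>
      grad (f i) \<theta> \<in> coords_below k \<and> grad (fenchel_conjugate (f i)) \<theta> \<in> coords_below k"
    and it: "i \<in> pverts G" "t < real k * (1 + \<Delta> * \<tau>) + 1 + delay k i * \<tau>"
  shows "mem X i t \<subseteq> coords_below k"
proof -
  \<comment> \<open>Time is continuous, but memories depend only on those at least \<open>\<delta>\<close> earlier, so induction on
    the number of steps of length \<open>\<delta>\<close> is possible.\<close>
  define \<delta> where "\<delta> = min 1 \<tau>"
  have \<delta>: "0 < \<delta>" "\<delta> \<le> 1" "\<delta> \<le> \<tau>" using \<open>0 < \<tau>\<close> by (auto simp: \<delta>_def)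
  have main: "mem X i t \<subseteq> coords_below k"
    if "t \<le> real N * \<delta>" "i \<in> pverts G" "t < real k * (1 + \<Delta> * \<tau>) + 1 + delay k i * \<tau>" for N i t k
    using that
  proof (induction N arbitrary: i t k)
    case 0
    then have "mem X i t \<subseteq> {0}"
      using exec by (cases "t < 0") (auto simp: black_box_execution_def)
    then show ?case by (auto simp: coords_below_def)
  next
    case (Suc N)
    show ?case
    proof (cases "t \<le> 0")
      case True
      then have "mem X i t \<subseteq> {0}"
        using exec Suc.prems by (cases "t < 0") (auto simp: black_box_execution_def)
      then show ?thesis by (auto simp: coords_below_def)
    next
      case False
      have comp: "comp_mem f X i t \<subseteq> coords_below k"
      proof -
        have before: "t - 1 \<le> real N * \<delta>"
          using Suc.prems(1) \<delta> by (simp add: algebra_simps)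
        have ind: "comp_mem f X i t \<subseteq> coords_below k"
          if "m \<le> k" "i \<noteq> source m" "mem X i (t - 1) \<subseteq> coords_below m" for m
          unfolding comp_mem_def using that inv[OF Suc.prems(2) that(2)] coords_below_mono[OF that(1)]
          by (intro span_minimal subspace_coords_below) blast
        show ?thesis
        proof (cases "i = source k")
          case False
          moreover have "mem X i (t - 1) \<subseteq> coords_below k"
            using Suc.IH[OF before Suc.prems(2), of k] Suc.prems(3) by simp
          ultimately show ?thesis using ind by blast
        next
          case True
          show ?thesis
          proof (cases k)
            case 0
            then have "t - 1 < 0" using True Suc.prems(3) uv by (simp add: source_def delay_def)
            then have "mem X i (t - 1) = {}"
              using exec Suc.prems(2) by (simp add: black_box_execution_def)
            then show ?thesis
              by (simp add: comp_mem_def coords_below_def)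
          next
            case (Suc m)
            \<comment> \<open>Before the computation, coordinate \<open>m\<close> cannot yet have crossed the distance \<open>\<Delta>\<close> from
              the other source, so even a vector with \<open>m\<close> coordinates is all that is available.\<close>
            have "i \<noteq> source m" "delay m i = \<Delta>" "delay k i = 0"
              using True Suc uv by (auto simp: source_def delay_def)
            moreover from this have "t - 1 < real m * (1 + \<Delta> * \<tau>) + 1 + delay m i * \<tau>"
              using Suc.prems(3) Suc by (simp add: algebra_simps)
            ultimately show ?thesis
              using ind[of m] Suc.IH[OF before Suc.prems(2), of m] Suc by simp
          qed
        qed
      qed
      have comm: "comm_mem G \<tau> X i t \<subseteq> coords_below k"
        unfolding comm_mem_def
      proof (intro span_minimal subspace_coords_below UN_least)
        fix j assume "j \<in> {j. (i, j) \<in> parcs G}"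
        then have e: "(i, j) \<in> parcs G" by simp
        have "delay k i \<le> delay k j + 1"
          using lip[OF e] by (auto simp: delay_def)
        then have "delay k i * \<tau> \<le> (delay k j + 1) * \<tau>"
          using \<open>0 < \<tau>\<close> by (intro mult_right_mono) auto
        then have "t - \<tau> < real k * (1 + \<Delta> * \<tau>) + 1 + delay k j * \<tau>"
          using Suc.prems(3) by (simp add: algebra_simps)
        moreover have "t - \<tau> \<le> real N * \<delta>"
          using Suc.prems(1) \<delta> by (simp add: algebra_simps)
        ultimately show "mem X j (t - \<tau>) \<subseteq> coords_below k"
          using Suc.IH verts[OF e] by blast
      qed
      have "mem X i t \<subseteq> comp_mem f X i t \<union> comm_mem G \<tau> X i t"
        using exec Suc.prems(2) False by (simp add: black_box_execution_def)
      with comp comm show ?thesis by blast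
    qed
  qed
  obtain N where "t / \<delta> \<le> real N" using real_arch_simple by blast
  then have "t \<le> real N * \<delta>" using \<delta> by (simp add: field_simps)
  then show ?thesis using main it by blast
qed

section \<open>The lower bound\<close>

text \<open>The factors \<open>n\<close> compensate for the division by \<open>n\<close> in the average.\<close>

definition split_chain :: "nat \<Rightarrow> nat \<Rightarrow> nat \<Rightarrow> real \<Rightarrow> real \<Rightarrow> ell2 \<Rightarrow> nat \<Rightarrow> ell2 \<Rightarrow> real" where
  "split_chain n u v \<alpha> s b i =
    (if i = u then quadratic (pair_hessian False (\<alpha> + n * s) (n * s)) (real n *\<^sub>R b)
     else if i = v then quadratic (pair_hessian True (\<alpha> + n * s) (n * s)) 0
     else quadratic (pair_hessian True \<alpha> 0) 0)"

lemma average_split_chain: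
  assumes "u \<in> {1..n}" "v \<in> {1..n}" "u \<noteq> v"
  shows "average n (split_chain n u v \<alpha> s b) = quadratic (chain_hessian \<alpha> s) b"
proof
  fix x :: ell2
  let ?q = "\<alpha> / 2 * inner x x"
  let ?g = "\<lambda>p. real n * s / 2 * (inner x x - inner x (swap p x))"
  have "split_chain n u v \<alpha> s b i x
      = ?q + (if i = u then ?g False - real n * inner b x else 0) + (if i = v then ?g True else 0)" for i
    using assms(3)
    by (auto simp: split_chain_def quadratic_def pair_hessian_def inner_diff_right inner_add_right scaleR_add_left field_simps)
  then have "(\<Sum>i=1..n. split_chain n u v \<alpha> s b i x)
      = real n * ?q + (?g False - real n * inner b x) + ?g True"
    using assms by (simp add: sum.distrib)
  then show "average n (split_chain n u v \<alpha> s b) x = quadratic (chain_hessian \<alpha> s) b x"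
    using assms by (simp add: average_def quadratic_def chain_hessian_def inner_diff_right inner_add_right scaleR_add_left field_simps)
qed

lemma admissible_split_chain:
  assumes "0 < \<alpha>" "0 \<le> s"
  shows "admissible n (split_chain n u v \<alpha> s b)"
proof -
  have local: "(\<exists>m>0. strongly_convex m (quadratic (pair_hessian p (\<alpha> + c) c) d)) \<and>
      (\<exists>M. smooth M (quadratic (pair_hessian p (\<alpha> + c) c) d))" if "0 \<le> c" for p c d
  proof (intro conjI exI)
    show "0 < \<alpha>" by (rule assms)
    show "strongly_convex \<alpha> (quadratic (pair_hessian p (\<alpha> + c) c) d)"
      using pair_hessian_coercive[OF that, of "\<alpha> + c"]
      by (intro strongly_convex_quadratic self_adjoint_pair_hessian) simp
    show "smooth (\<alpha> + c + c) (quadratic (pair_hessian p (\<alpha> + c) c) d)"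
      using that assms(1)
      by (intro smooth_quadratic self_adjoint_pair_hessian norm_pair_hessian_le) auto
  qed
  have "0 \<le> real n * s" using assms(2) by simp
  from local[OF this] local[OF order_refl] show ?thesis
    unfolding admissible_def split_chain_def by simp
qed

text \<open>Only \<open>u\<close> can extend a vector with an even number of leading coordinates, and only \<open>v\<close> one with
  an odd number: for the other parity their pairs, and for \<open>u\<close> also the support of \<open>b\<close>, lie within
  these coordinates or outside.\<close>

lemma oracles_split_chain:
  assumes "0 < \<alpha>" "0 \<le> s" "b \<in> coords_below 1" "u \<noteq> v"
    and "i \<noteq> (if even k then u else v)" "\<theta> \<in> coords_below k"
  shows "grad (split_chain n u v \<alpha> s b i) \<theta> \<in> coords_below k"
    "grad (fenchel_conjugate (split_chain n u v \<alpha> s b i)) \<theta> \<in> coords_below k"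
proof -
  have z: "0 \<in> coords_below k" by (rule subspace_0[OF subspace_coords_below])
  have nb: "real n *\<^sub>R b \<in> coords_below k" if "odd k"
    using that assms(3) coords_below_mono[of 1 k]
    by (intro subspace_scale[OF subspace_coords_below]) (auto simp: Suc_le_eq odd_pos)
  note inv = pair_quadratic_oracles_coords_below[OF _ _ _ _ assms(6)]
  show "grad (split_chain n u v \<alpha> s b i) \<theta> \<in> coords_below k"
    "grad (fenchel_conjugate (split_chain n u v \<alpha> s b i)) \<theta> \<in> coords_below k"
    using assms(1,2,4,5) nb z unfolding split_chain_def
    by (auto intro!: inv split: if_splits)
qed

text \<open>With \<open>r = \<surd>\<kappa>\<close> and \<open>\<beta> = \<alpha> r\<^sup>2\<close>, the ratio \<open>q\<close> is the characteristic root below 1 of the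
  recurrence of the chain.\<close>

lemma rate_equation:
  fixes r \<alpha> :: real
  assumes "1 < r"
  defines "q \<equiv> (r - 1) / (r + 1)" and "s \<equiv> (\<alpha> * r\<^sup>2 - \<alpha>) / 4"
  shows "(\<alpha> + 2 * s) * q = s * (q\<^sup>2 + 1)"
proof -
  have r: "r + 1 \<noteq> 0" using assms(1) by simp
  have s: "4 * s = \<alpha> * r\<^sup>2 - \<alpha>" by (simp add: s_def)
  have "q * (r + 1) = r - 1" using r by (simp add: q_def)
  then have "((\<alpha> + 2 * s) * q) * (r + 1)\<^sup>2 = (s * (q\<^sup>2 + 1)) * (r + 1)\<^sup>2"
    using s by algebra
  then show ?thesis using r by simp
qed

lemma ln_inverse_rate_le:
  fixes r :: real
  assumes "1 < r"
  shows "ln (1 / ((r - 1) / (r + 1))) \<le> 2 / (r - 1)"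
proof -
  have "1 / ((r - 1) / (r + 1)) = 1 + 2 / (r - 1)"
    using assms by (simp add: divide_simps)
  then show ?thesis using ln_add_one_self_le_self[of "2 / (r - 1)"] assms by simp
qed

text \<open>Taking logarithms in \<open>q\<^sup>2\<^sup>m \<le> \<epsilon>\<close> gives \<open>m \<ge> (r - 1) / 4 * ln (1/\<epsilon>)\<close>, and \<open>r0 \<le> r\<close> gives
  \<open>r - 1 \<ge> (1 - 1 / r0) r\<close>.\<close>

lemma time_lower_bound:
  fixes r :: real and m :: nat
  assumes r: "1 < r0" "r0 \<le> r" and "0 < D" "0 < \<epsilon>" "0 \<le> t" "real m \<le> t / D"
    and gap: "((r - 1) / (r + 1)) ^ (2 * m) \<le> \<epsilon>"
  shows "(1 - 1 / r0) / 4 * (r * D * ln (1 / \<epsilon>)) \<le> t"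
proof (cases "ln (1 / \<epsilon>) \<le> 0")
  case True
  have "0 \<le> (1 - 1 / r0) / 4 * (r * D)"
    using assms by simp
  then have "(1 - 1 / r0) / 4 * (r * D) * ln (1 / \<epsilon>) \<le> 0"
    using True by (rule mult_nonneg_nonpos)
  then show ?thesis using \<open>0 \<le> t\<close> by (simp add: mult.assoc)
next
  case False
  define q where "q = (r - 1) / (r + 1)"
  have q: "0 < q" using r by (simp add: q_def)
  have "ln (1 / \<epsilon>) \<le> ln (1 / q ^ (2 * m))"
    using gap[folded q_def] q \<open>0 < \<epsilon>\<close> by (intro ln_mono) (auto simp: field_simps)
  also have "\<dots> = 2 * real m * ln (1 / q)"
    using q by (simp add: ln_div ln_realpow)
  also have "\<dots> \<le> 2 * real m * (2 / (r - 1))"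
    unfolding q_def using r by (intro mult_left_mono ln_inverse_rate_le) auto
  finally have "(r - 1) / 4 * ln (1 / \<epsilon>) \<le> real m"
    using r by (simp add: field_simps)
  moreover have "(1 - 1 / r0) * r \<le> r - 1"
    using r by (simp add: field_simps)
  then have "(1 - 1 / r0) * r / 4 * ln (1 / \<epsilon>) \<le> (r - 1) / 4 * ln (1 / \<epsilon>)"
    using False by (intro mult_right_mono) auto
  ultimately have "(1 - 1 / r0) * r / 4 * ln (1 / \<epsilon>) \<le> t / D"
    using \<open>real m \<le> t / D\<close> by linarith
  then show ?thesis using \<open>0 < D\<close> by (simp add: field_simps)
qed

theorem corollary1:
  fixes \<kappa>\<^sub>0 :: real
  assumes "\<kappa>\<^sub>0 > 1"
  shows "\<exists>C>0. \<forall>\<alpha> \<beta> \<kappa> \<tau> n G P.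
    0 < \<alpha> \<and> \<alpha> \<le> \<beta> \<and> \<kappa> = \<beta> / \<alpha> \<and> \<kappa>\<^sub>0 \<le> \<kappa> \<and> 0 < \<tau> \<and>
    network n G \<and> graph_diameter G > 0 \<and> black_box_procedure n G \<tau> P \<longrightarrow>
    (\<exists>f. admissible n f \<and>
         strongly_convex \<alpha> (average n f) \<and> smooth \<beta> (average n f) \<and>
         (\<forall>\<epsilon>>0. time_to_precision n f (P f) \<epsilon>
                   \<ge> ereal (C * (sqrt \<kappa> * (1 + graph_diameter G * \<tau>) * ln (1 / \<epsilon>)))))"
proof (intro exI[of _ "(1 - 1 / sqrt \<kappa>\<^sub>0) / 4"] conjI allI impI)
  show "0 < (1 - 1 / sqrt \<kappa>\<^sub>0) / 4" using assms by simp
next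
  fix \<alpha> \<beta> \<kappa> \<tau> :: real and n G P
  assume "0 < \<alpha> \<and> \<alpha> \<le> \<beta> \<and> \<kappa> = \<beta> / \<alpha> \<and> \<kappa>\<^sub>0 \<le> \<kappa> \<and> 0 < \<tau> \<and>
    network n G \<and> graph_diameter G > 0 \<and> black_box_procedure n G \<tau> P"
  then have "0 < \<alpha>" "\<alpha> \<le> \<beta>" and \<kappa>: "\<kappa> = \<beta> / \<alpha>" "\<kappa>\<^sub>0 \<le> \<kappa>" and "0 < \<tau>"
    and net: "network n G" and diam: "graph_diameter G > 0" and proc: "black_box_procedure n G \<tau> P"
    by auto
  obtain u v h where uv: "u \<in> pverts G" "v \<in> pverts G" and h: "h u = 0" "h v = graph_diameter G"
    and lip: "\<forall>i j. (i, j) \<in> parcs G \<longrightarrow> \<bar>h i - h j\<bar> \<le> 1"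
    by (rule network_distance_function[OF net diam])
  have V: "pverts G = {1..n}" and "pair_graph G" using net by (auto simp: network_def)
  then interpret pair_graph G by simp
  have "u \<noteq> v" using h diam by auto
  define r where "r = sqrt \<kappa>"
  define q where "q = (r - 1) / (r + 1)"
  define s where "s = (\<beta> - \<alpha>) / 4"
  have r: "1 < sqrt \<kappa>\<^sub>0" "sqrt \<kappa>\<^sub>0 \<le> r" using assms \<kappa> by (auto simp: r_def)
  then have r1: "1 < r" by linarith
  then have q: "0 < q" "q < 1" by (auto simp: q_def)
  have "r\<^sup>2 = \<kappa>" using assms \<kappa> by (simp add: r_def)
  then have \<beta>: "\<beta> = \<alpha> * r\<^sup>2" using \<kappa> \<open>0 < \<alpha>\<close> by simp
  have "0 \<le> s" using \<open>\<alpha> \<le> \<beta>\<close> by (simp add: s_def)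
  \<comment> \<open>This scale makes the gap at a point with \<open>m + 1\<close> leading coordinates at least \<open>q\<^sup>2\<^sup>m\<close>,
    with no constant in front.\<close>
  define c where "c = sqrt (2 / \<alpha>) / q"
  define z where "z = geometric c q"
  define b where "b = chain_hessian \<alpha> s z"
  define f where "f = split_chain n u v \<alpha> s b"
  have b: "b \<in> coords_below 1"
    unfolding b_def z_def using rate_equation[OF r1, of \<alpha>] q
    by (intro chain_hessian_geometric) (auto simp: q_def s_def \<beta>)
  have avg: "average n f = quadratic (chain_hessian \<alpha> s) b"
    unfolding f_def using uv \<open>u \<noteq> v\<close> V by (intro average_split_chain) auto
  have adm: "admissible n f"
    unfolding f_def using \<open>0 < \<alpha>\<close> \<open>0 \<le> s\<close> by (rule admissible_split_chain)
  then have exec: "black_box_execution G \<tau> f (P f)"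
    using proc by (simp add: black_box_procedure_def)
  have growth: "\<alpha> / 2 * (norm (x - z))\<^sup>2 \<le> average n f x - average n f z" for x
    unfolding avg b_def using \<open>0 \<le> s\<close>
    by (intro quadratic_growth self_adjoint_chain_hessian chain_hessian_coercive refl)
  have min: "average n f (arg_min (average n f) (\<lambda>_. True)) \<le> average n f z"
  proof (rule arg_minI[of "\<lambda>_. True" z])
    show "\<not> average n f y < average n f z" for y
      using growth[of y] \<open>0 < \<alpha>\<close>
      by (smt (verit) divide_pos_pos mult_nonneg_nonneg zero_le_power2)
  qed (simp_all add: not_less)
  have bound: "(1 - 1 / sqrt \<kappa>\<^sub>0) / 4 * (r * (1 + graph_diameter G * \<tau>) * ln (1 / \<epsilon>)) \<le> t"
    if "0 < \<epsilon>" "0 \<le> t"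
      and prec: "\<forall>i\<in>{1..n}. average n f (outp (P f) i t)
        - average n f (arg_min (average n f) (\<lambda>_. True)) \<le> \<epsilon>" for \<epsilon> t
  proof (rule time_lower_bound)
    define D where "D = 1 + graph_diameter G * \<tau>"
    have D: "0 < D" using diam \<open>0 < \<tau>\<close> by (simp add: D_def add_pos_pos)
    define m where "m = nat \<lfloor>t / D\<rfloor>"
    have m: "real m \<le> t / D" "t / D < real m + 1"
      using \<open>0 \<le> t\<close> D by (auto simp: m_def of_nat_nat)
    show "0 < D" "real m \<le> t / D" by fact+
    define y where "y = outp (P f) u t"
    have "t < real (m + 1) * D" using m D by (simp add: field_simps)
    moreover have "0 \<le> (if even (m + 1) then h u else graph_diameter G - h u) * \<tau>"
      using h diam \<open>0 < \<tau>\<close> by simp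
    ultimately have "mem (P f) u t \<subseteq> coords_below (m + 1)"
      using exec \<open>0 < \<tau>\<close> \<open>u \<noteq> v\<close> h lip uv
      by (intro memory_confined[where h = h and u = u and v = v and \<Delta> = "graph_diameter G"])
        (auto simp: f_def D_def in_arcsD2 intro!: oracles_split_chain \<open>0 < \<alpha>\<close> \<open>0 \<le> s\<close> b)
    moreover have "y \<in> mem (P f) u t"
      using exec uv \<open>0 \<le> t\<close> by (simp add: y_def black_box_execution_def)
    ultimately have "coord y (m + 1) = 0" by (auto simp: coords_below_def)
    then have "(c * q ^ (m + 1))\<^sup>2 \<le> (norm (y - z))\<^sup>2"
      using coord_power2_le_norm[of "y - z" "m + 1"] q by (simp add: z_def coord_geometric)
    then have "\<alpha> / 2 * (c * q ^ (m + 1))\<^sup>2 \<le> \<alpha> / 2 * (norm (y - z))\<^sup>2"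
      using \<open>0 < \<alpha>\<close> by (intro mult_left_mono) auto
    also have "\<dots> \<le> average n f y - average n f z" by (rule growth)
    also have "\<dots> \<le> \<epsilon>"
      using bspec[OF prec, of u] uv(1) min unfolding V y_def by linarith
    also have "\<alpha> / 2 * (c * q ^ (m + 1))\<^sup>2 = q ^ (2 * m)"
      using q \<open>0 < \<alpha>\<close> by (simp add: c_def power_mult_distrib power_even_eq)
    finally show "((r - 1) / (r + 1)) ^ (2 * m) \<le> \<epsilon>" by (simp add: q_def)
  qed (use r that in auto)
  show "\<exists>f. admissible n f \<and>
         strongly_convex \<alpha> (average n f) \<and> smooth \<beta> (average n f) \<and>
         (\<forall>\<epsilon>>0. time_to_precision n f (P f) \<epsilon>
           \<ge> ereal ((1 - 1 / sqrt \<kappa>\<^sub>0) / 4 * (sqrt \<kappa> * (1 + graph_diameter G * \<tau>) * ln (1 / \<epsilon>))))"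
  proof (intro exI[of _ f] conjI allI impI adm)
    show "strongly_convex \<alpha> (average n f)"
      unfolding avg using \<open>0 \<le> s\<close>
      by (intro strongly_convex_quadratic self_adjoint_chain_hessian chain_hessian_coercive)
    have "\<beta> = \<alpha> + 4 * s" by (simp add: s_def field_simps)
    then show "smooth \<beta> (average n f)"
      unfolding avg using \<open>0 \<le> s\<close> \<open>0 < \<alpha>\<close> norm_chain_hessian_le[of s \<alpha>]
      by (intro smooth_quadratic self_adjoint_chain_hessian) auto
    fix \<epsilon> :: real assume "0 < \<epsilon>"
    then show "ereal ((1 - 1 / sqrt \<kappa>\<^sub>0) / 4 * (sqrt \<kappa> * (1 + graph_diameter G * \<tau>) * ln (1 / \<epsilon>)))
        \<le> time_to_precision n f (P f) \<epsilon>"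
      unfolding time_to_precision_def Let_def r_def[symmetric]
    proof (intro Inf_greatest, clarify)
      fix t
      assume "0 \<le> t" "\<forall>i\<in>{1..n}. average n f (outp (P f) i t)
        - average n f (arg_min (average n f) (\<lambda>_. True)) \<le> \<epsilon>"
      with \<open>0 < \<epsilon>\<close> show "ereal ((1 - 1 / sqrt \<kappa>\<^sub>0) / 4 * (r * (1 + graph_diameter G * \<tau>) * ln (1 / \<epsilon>)))
          \<le> ereal t"
        unfolding ereal_less_eq(3) by (rule bound)
    qed
  qed
qed

end
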